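(* Let $n\ge 1$ be an integer and let $n-1<\alpha<n$. Let $f$ be a function with history $f_{in}$ on the initialization period $[-a,0]$, and put $$\mu_{n-\alpha}(\omega)=\frac{\sin((n-\alpha)\pi)}{\pi}\,\omega^{-(n-\alpha)},$$ where the elementary frequency $\omega$ ranges from $0$ to $\infty$. Then the initialized Riemann-Liouville derivative of order $\alpha$ of $f$ has the diffusive representation $${}_{0}^{RL}D_{t}^{\alpha}f(t)=\frac{d^{n}}{dt^{n}}\int_{0}^{\infty}\mu_{n-\alpha}(\omega)\,z_{RL}(\omega,t)\,d\omega,$$ where $z_{RL}(\omega,t)$ satisfies $$\frac{\partial z_{RL}(\omega,t)}{\partial t}=-\omega z_{RL}(\omega,t)+f(t),\qquad z_{RL}(\omega,0)=\int_{-a}^{0}e^{-\omega\tau}f_{in}(\tau)\,d\tau,$$ and the initialized Caputo derivative of order $\alpha$ of $f$ has the diffusive representation $${}_{0}^{C}D_{t}^{\alpha}f(t)=\int_{0}^{\infty}\mu_{n-\alpha}(\omega)\,z_{C}(\omega,t)\,d\omega,$$ where $z_{C}(\omega,t)$ satisfies $$\frac{\partial z_{C}(\omega,t)}{\partial t}=-\omega z_{C}(\omega,t)+f^{(n)}(t),\qquad z_{C}(\omega,0)=\int_{-a}^{0}e^{-\omega\tau}f_{in}^{(n)}(\tau)\,d\tau.$$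
   Context: In the initialization theory for fractional calculus, the integrand of the Riemann-Liouville fractional integral is represented as the composite function $v(t)=0$ for $t<-a$, $v(t)=f_{in}(t)$ for $-a\le t\le 0$, $v(t)=f(t)$ for $t>0$. Here $t=-a$ is the starting time of the integral, $t=0$ is the initial time, $f_{in}$ describes the behaviour during the initialization period $[-a,0]$, and $f$ is the function of primary interest after $t=0$. The initialized Riemann-Liouville fractional integral of order $\beta$ ($0<\beta<1$) is $${}_{0}D_{t}^{-\beta}f(t)=\frac{1}{\Gamma(\beta)}\int_{0}^{t}(t-\tau)^{\beta-1}f(\tau)\,d\tau+\psi(t),\qquad t>0,$$ where $\psi(t)$ is the initialization function, describing the hereditary effect of the past, i.e. of the history on $[-a,0]$ of the integrand $v$, whose integration starts at time $-a$. For $n-1<\alpha<n$ the initialized Riemann-Liouville derivative is ${}_{0}^{RL}D_{t}^{\alpha}f(t)=\dfrac{d^{n}}{dt^{n}}\,{}_{0}D_{t}^{\alpha-n}f(t)$, the integral ${}_{0}D_{t}^{\alpha-n}={}_{0}D_{t}^{-(n-\alpha)}$ being initialized with the history $f_{in}$. The initialized Caputo derivative is ${}_{0}^{C}D_{t}^{\alpha}f(t)={}_{0}D_{t}^{\alpha-n}f^{(n)}(t)$, the integral being initialized with the history $f_{in}^{(n)}$ of $f^{(n)}$.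
   Formalization: Both initial conditions use e^{ωτ} instead of e^{-ωτ}, since the printed sign makes the frequency integral diverge (e.g. f=f_in=1, a=1, n=1, t<1); f (resp. f^(n)) is assumed locally integrable and continuous for t>0, and the history (resp. its n-th derivative) integrable. *)

theory Defs
  imports "HOL-Analysis.Analysis"
begin

text \<open>
  Initialized fractional integral of order \<open>\<beta>\<close>.  The integrand is \<open>f\<close> for positive times and has
  the history \<open>fin\<close> on \<open>[-a, 0]\<close>.  The hereditary term \<open>\<psi>\<close> is the part that the history contributes
  to the Riemann-Liouville integral started at \<open>-a\<close>.  All notions below are meant for \<open>t > 0\<close>.
\<close>

definition init_function :: "real \<Rightarrow> real \<Rightarrow> (real \<Rightarrow> real) \<Rightarrow> real \<Rightarrow> real" where
  "init_function \<beta> a fin t =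
     1 / Gamma \<beta> * integral {-a..0} (\<lambda>\<tau>. (t - \<tau>) powr (\<beta> - 1) * fin \<tau>)"

definition init_integral ::
    "real \<Rightarrow> real \<Rightarrow> (real \<Rightarrow> real) \<Rightarrow> (real \<Rightarrow> real) \<Rightarrow> real \<Rightarrow> real" where
  "init_integral \<beta> a fin f t =
     1 / Gamma \<beta> * integral {0..t} (\<lambda>\<tau>. (t - \<tau>) powr (\<beta> - 1) * f \<tau>) + init_function \<beta> a fin t"

definition init_RL_deriv ::
    "nat \<Rightarrow> real \<Rightarrow> real \<Rightarrow> (real \<Rightarrow> real) \<Rightarrow> (real \<Rightarrow> real) \<Rightarrow> real \<Rightarrow> real" where
  "init_RL_deriv n \<alpha> a fin f = (deriv ^^ n) (init_integral (real n - \<alpha>) a fin f)"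

text \<open>
  The values of \<open>(deriv ^^ n) fin\<close> at the two end points of \<open>[-a, 0]\<close> carry no meaning, but they
  do not influence the integral.
\<close>

definition init_Caputo_deriv ::
    "nat \<Rightarrow> real \<Rightarrow> real \<Rightarrow> (real \<Rightarrow> real) \<Rightarrow> (real \<Rightarrow> real) \<Rightarrow> real \<Rightarrow> real" where
  "init_Caputo_deriv n \<alpha> a fin f =
     init_integral (real n - \<alpha>) a ((deriv ^^ n) fin) ((deriv ^^ n) f)"

text \<open>
  Only used for open \<open>S\<close>: all derivatives up to order \<open>n\<close> exist on \<open>S\<close>, so that \<open>(deriv ^^ n) g\<close>
  is the genuine \<open>n\<close>-th derivative there.
\<close>

definition n_times_differentiable_on :: "nat \<Rightarrow> (real \<Rightarrow> real) \<Rightarrow> real set \<Rightarrow> bool" where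
  "n_times_differentiable_on n g S \<longleftrightarrow> (\<forall>k<n. \<forall>x\<in>S. (deriv ^^ k) g differentiable (at x))"

text \<open>
  Standing regularity of an integrand and its history: the integrals defining the initialized
  integral exist (an integrable singularity at \<open>0\<close> is allowed), and the differential equation of
  the diffusive state can hold in the classical sense at every \<open>t > 0\<close>.
\<close>

definition admissible :: "real \<Rightarrow> (real \<Rightarrow> real) \<Rightarrow> (real \<Rightarrow> real) \<Rightarrow> bool" where
  "admissible a fin f \<longleftrightarrow>
     fin absolutely_integrable_on {-a..0} \<and>
     (\<forall>T>0. f absolutely_integrable_on {0..T}) \<and>
     continuous_on {0<..} f"

definition diffusive_weight :: "real \<Rightarrow> real \<Rightarrow> real" where
  "diffusive_weight \<beta> \<omega> = sin (\<beta> * pi) / pi * \<omega> powr (- \<beta>)"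

text \<open>
  The frequency distributed state.  Its value at time \<open>0\<close> is that of the solution of
  \<open>z' = - \<omega> z + fin\<close> started from rest at time \<open>-a\<close>, that is the integral over \<open>[-a, 0]\<close> of
  \<open>exp (- \<omega> (0 - \<tau>)) * fin \<tau>\<close>.  The kernel is thus \<open>exp (\<omega> \<tau>)\<close> with \<open>\<tau> \<le> 0\<close>; the kernel
  \<open>exp (- \<omega> \<tau>)\<close>, sometimes printed instead, would grow like \<open>exp (\<omega> a)\<close> and make the integral over
  all frequencies diverge for \<open>t < a\<close>.
\<close>

definition diffusive_state ::
    "real \<Rightarrow> (real \<Rightarrow> real) \<Rightarrow> (real \<Rightarrow> real) \<Rightarrow> (real \<Rightarrow> real \<Rightarrow> real) \<Rightarrow> bool" where
  "diffusive_state a fin f z \<longleftrightarrow>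
     (\<forall>\<omega>\<ge>0.
        continuous_on {0..} (z \<omega>) \<and>
        (\<forall>t>0. (z \<omega> has_real_derivative (- \<omega> * z \<omega> t + f t)) (at t)) \<and>
        z \<omega> 0 = integral {-a..0} (\<lambda>\<tau>. exp (\<omega> * \<tau>) * fin \<tau>))"

definition diffusive_output :: "real \<Rightarrow> (real \<Rightarrow> real \<Rightarrow> real) \<Rightarrow> real \<Rightarrow> real" where
  "diffusive_output \<beta> z t = integral {0..} (\<lambda>\<omega>. diffusive_weight \<beta> \<omega> * z \<omega> t)"

end

theory Submission
  imports Defs
begin

text \<open>
  Put \<open>\<beta> = n - \<alpha>\<close>, so that \<open>0 < \<beta> < 1\<close>.  The substitution \<open>u = \<omega> s\<close> in the integral for
  \<open>Gamma (1 - \<beta>)\<close> and the reflection formula show that the weakly singular kernel is a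
  superposition of decaying exponentials: the integral of
  \<open>diffusive_weight \<beta> \<omega> * exp (- \<omega> s)\<close> over all \<open>\<omega> > 0\<close> equals \<open>s powr (\<beta> - 1) / Gamma \<beta>\<close>
  for every \<open>s > 0\<close> (\<open>frequency_integral\<close>, \<open>Gamma_reflection_real\<close>).

  The state equation is linear of first order, so variation of constants determines its solution:
  \<open>z \<omega> t\<close> is the integral of \<open>exp (- \<omega> (t - \<tau>))\<close> against the history on \<open>[-a, 0]\<close> plus the same
  integral against \<open>f\<close> on \<open>[0, t]\<close> (\<open>driven_state\<close>, \<open>diffusive_state_driven_state\<close>,
  \<open>diffusive_state_unique\<close>).  Integrating this against the weight and exchanging the order of
  integration (\<open>frequency_superposition\<close>) turns the exponentials into the fractional kernel, and
  the output of the state is the initialized integral of order \<open>\<beta>\<close> at every \<open>t > 0\<close>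
  (\<open>diffusive_output_eq_init_integral\<close>).  Fubini's theorem applies because
  \<open>(t - \<tau>) powr (\<beta> - 1)\<close> times the integrand is absolutely integrable: near its singularity
  \<open>\<tau> = t > 0\<close> the integrand is bounded by continuity, and away from it the kernel is bounded.

  The Caputo claim is this identity for the \<open>n\<close>-th derivatives.  The Riemann-Liouville claim
  follows by differentiating it \<open>n\<close> times on the open half line; since the two functions agree
  there, they are differentiable to the same order.
\<close>

section \<open>Superposition of exponentials\<close>

lemma sigma_finite_completion:
  assumes "sigma_finite_measure M"
  shows "sigma_finite_measure (completion M)"
proof -
  obtain A where A: "countable A" "A \<subseteq> sets M" "\<Union>A = space M" "\<forall>a\<in>A. emeasure M a \<noteq> \<infinity>"
    using sigma_finite_measure.sigma_finite_countable[OF assms] by blast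
  show ?thesis
    by standard (use A in \<open>auto intro!: exI[of _ A]\<close>)
qed

text \<open>
  Gamma's integral at \<open>1 - \<beta>\<close> with the variable rescaled by \<open>s\<close>.  It is computed first as a
  nonnegative integral, where the rescaling needs no integrability; finiteness then comes for free.
\<close>
lemma frequency_integral:
  fixes \<beta> s :: real
  assumes "\<beta> < 1" and s: "s > 0"
  shows "has_bochner_integral lebesgue
           (\<lambda>\<omega>. indicator {0..} \<omega> * (\<omega> powr (- \<beta>) * exp (- (\<omega> * s))))
           (Gamma (1 - \<beta>) * s powr (\<beta> - 1))"
proof -
  let ?g = "\<lambda>\<omega>::real. indicator {0..} \<omega> * (\<omega> powr (- \<beta>) * exp (- (\<omega> * s)))"
  have "ennreal (Gamma (1 - \<beta>)) = 
      (\<integral>\<^sup>+ t. ennreal (indicator {0..} t * t powr (1 - \<beta> - 1) / exp t) \<partial>lborel)"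
    using assms by (intro Gamma_conv_nn_integral_real) auto
  also have "\<dots> = \<bar>s\<bar> * (\<integral>\<^sup>+ t. ennreal (indicator {0..} (0 + s * t) * (0 + s * t) powr (1 - \<beta> - 1) / exp (0 + s * t)) \<partial>lborel)"
    using s by (intro nn_integral_real_affine) auto
  also have "\<dots> = s * (\<integral>\<^sup>+ t. ennreal (s powr (-\<beta>)) * ennreal (?g t) \<partial>lborel)"
    using s by (intro arg_cong2[where f="(*)"] nn_integral_cong)
       (auto simp: indicator_def powr_mult zero_le_mult_iff exp_minus field_simps simp flip: ennreal_mult)
  also have "\<dots> = ennreal s * (ennreal (s powr (-\<beta>)) * (\<integral>\<^sup>+ t. ennreal (?g t) \<partial>lborel))"
    by (subst nn_integral_cmult) auto
  also have "\<dots> = ennreal (s powr (1 - \<beta>)) * (\<integral>\<^sup>+ t. ennreal (?g t) \<partial>lborel)"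
    using s by (simp add: powr_diff powr_minus field_simps flip: mult.assoc ennreal_mult)
  finally have *: "ennreal (Gamma (1 - \<beta>)) = ennreal (s powr (1 - \<beta>)) * (\<integral>\<^sup>+ t. ennreal (?g t) \<partial>lborel)" .
  have "(\<integral>\<^sup>+ t. ennreal (?g t) \<partial>lborel) = ennreal (s powr (\<beta> - 1)) * (ennreal (s powr (1 - \<beta>)) * (\<integral>\<^sup>+ t. ennreal (?g t) \<partial>lborel))"
    using s by (simp flip: mult.assoc ennreal_mult powr_add)
  also have "\<dots> = ennreal (Gamma (1 - \<beta>) * s powr (\<beta> - 1))"
    using assms by (simp flip: * ennreal_mult'' add: mult.commute)
  finally have "has_bochner_integral lborel ?g (Gamma (1 - \<beta>) * s powr (\<beta> - 1))"
    using assms by (intro has_bochner_integral_nn_integral) (auto intro!: mult_nonneg_nonneg Gamma_real_nonneg)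
  then show ?thesis
    by (simp add: has_bochner_integral_iff integrable_completion integral_completion)
qed

text \<open>
  Fubini's theorem for \<open>\<omega> powr (- \<beta>) * exp (- \<omega> (t - \<tau>)) * v \<tau>\<close>.  The set \<open>S\<close> is kept general so
  that the history and the interval after the initial time are both instances.  The integrand
  \<open>v\<close> is only Lebesgue measurable, so the product is taken of two copies of \<open>lebesgue\<close> rather than
  of \<open>lborel\<close>.
\<close>
lemma frequency_superposition:
  fixes v :: "real \<Rightarrow> real"
  assumes "\<beta> < 1" and S: "S \<in> sets lebesgue" "S \<subseteq> {..t}"
    and v: "v absolutely_integrable_on S"
    and k: "(\<lambda>\<tau>. (t - \<tau>) powr (\<beta> - 1) * v \<tau>) absolutely_integrable_on S"
  shows "(\<lambda>\<omega>. \<omega> powr (- \<beta>) * integral S (\<lambda>\<tau>. exp (- (\<omega> * (t - \<tau>))) * v \<tau>))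
           absolutely_integrable_on {0..}"
    and "integral {0..} (\<lambda>\<omega>. \<omega> powr (- \<beta>) * integral S (\<lambda>\<tau>. exp (- (\<omega> * (t - \<tau>))) * v \<tau>))
           = Gamma (1 - \<beta>) * integral S (\<lambda>\<tau>. (t - \<tau>) powr (\<beta> - 1) * v \<tau>)"
proof -
  interpret sigma_finite_measure "lebesgue :: real measure"
    by (rule sigma_finite_completion) (rule sigma_finite_lborel)
  interpret pair_sigma_finite "lebesgue :: real measure" "lebesgue :: real measure" ..
  define w where "w \<tau> = indicator S \<tau> * v \<tau>" for \<tau>
  define F where "F \<tau> \<omega> = w \<tau> * (indicator {0..} \<omega> * (\<omega> powr (- \<beta>) * exp (- (\<omega> * (t - \<tau>)))))" for \<tau> \<omega>
  have w[measurable]: "w \<in> borel_measurable lebesgue"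
    using v unfolding set_integrable_def w_def by auto
  have id[measurable]: "(\<lambda>x::real. x) \<in> lebesgue \<rightarrow>\<^sub>M borel"
    by (rule measurable_completion) simp
  have [measurable]: "fst \<in> (lebesgue \<Otimes>\<^sub>M lebesgue :: (real \<times> real) measure) \<rightarrow>\<^sub>M borel"
    using measurable_compose[OF measurable_fst id] by simp
  have [measurable]: "snd \<in> (lebesgue \<Otimes>\<^sub>M lebesgue :: (real \<times> real) measure) \<rightarrow>\<^sub>M borel"
    using measurable_compose[OF measurable_snd id] by simp
  have [measurable]: "(\<lambda>p. w (fst p)) \<in> borel_measurable (lebesgue \<Otimes>\<^sub>M lebesgue :: (real \<times> real) measure)"
    using measurable_compose[OF measurable_fst w] by simp
  have [measurable]: "(\<lambda>p. indicator {0..} (snd p) :: real) \<in> borel_measurable (lebesgue \<Otimes>\<^sub>M lebesgue :: (real \<times> real) measure)"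
    by measurable
  have F_meas: "case_prod F \<in> borel_measurable (lebesgue \<Otimes>\<^sub>M lebesgue)"
    unfolding F_def case_prod_beta by measurable
  \<comment> \<open>At \<open>\<tau> = t\<close> there is no decay in \<open>\<omega>\<close>, and the frequency integral diverges.\<close>
  have ae: "AE \<tau> in lebesgue. \<tau> \<noteq> t"
    by (intro AE_completion AE_lborel_singleton)
  have F_int: "has_bochner_integral lebesgue (F \<tau>) (w \<tau> * (Gamma (1 - \<beta>) * (t - \<tau>) powr (\<beta> - 1)))"
    if "\<tau> \<noteq> t" for \<tau>
  proof (cases "\<tau> < t")
    case True
    then show ?thesis
      unfolding F_def using frequency_integral[OF assms(1), of "t - \<tau>"]
      by (intro has_bochner_integral_mult_right) auto
  next
    case False
    then have "w \<tau> = 0" using that S(2) by (auto simp: w_def indicator_def)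
    then have "F \<tau> = (\<lambda>\<omega>. 0)" by (simp add: F_def fun_eq_iff)
    with \<open>w \<tau> = 0\<close> show ?thesis by (simp add: has_bochner_integral_iff)
  qed
  have F_abs: "(\<integral>\<omega>. norm (F \<tau> \<omega>) \<partial>lebesgue) = \<bar>w \<tau>\<bar> * (Gamma (1 - \<beta>) * (t - \<tau>) powr (\<beta> - 1))"
    if "\<tau> \<noteq> t" for \<tau>
  proof -
    have "norm (F \<tau> \<omega>) = sgn (w \<tau>) * F \<tau> \<omega>" for \<omega>
      by (simp add: F_def abs_mult sgn_if)
    then show ?thesis
      using F_int[OF that] by (simp add: has_bochner_integral_iff sgn_if)
  qed
  have k': "integrable lebesgue (\<lambda>\<tau>. w \<tau> * (t - \<tau>) powr (\<beta> - 1))"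
    using k unfolding set_integrable_def w_def by (simp add: ac_simps)
  have "integrable lebesgue (\<lambda>\<tau>. \<integral>\<omega>. norm (F \<tau> \<omega>) \<partial>lebesgue)"
  proof (rule integrable_cong_AE_imp)
    show "integrable lebesgue (\<lambda>\<tau>. Gamma (1 - \<beta>) * norm (w \<tau> * (t - \<tau>) powr (\<beta> - 1)))"
      by (intro integrable_mult_right integrable_norm k')
    show "(\<lambda>\<tau>. \<integral>\<omega>. norm (F \<tau> \<omega>) \<partial>lebesgue) \<in> borel_measurable lebesgue"
      using F_meas by measurable
    show "AE \<tau> in lebesgue. Gamma (1 - \<beta>) * norm (w \<tau> * (t - \<tau>) powr (\<beta> - 1)) =
        (\<integral>\<omega>. norm (F \<tau> \<omega>) \<partial>lebesgue)"
      using ae by eventually_elim (simp add: F_abs[unfolded real_norm_def] abs_mult)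
  qed
  moreover have "AE \<tau> in lebesgue. integrable lebesgue (F \<tau>)"
    using ae by eventually_elim (use F_int in \<open>auto simp: has_bochner_integral_iff\<close>)
  ultimately have F2: "integrable (lebesgue \<Otimes>\<^sub>M lebesgue) (case_prod F)"
    using F_meas by (intro Fubini_integrable) auto
  define Z where "Z \<omega> = \<omega> powr (- \<beta>) * integral S (\<lambda>\<tau>. exp (- (\<omega> * (t - \<tau>))) * v \<tau>)" for \<omega>
  have inner: "(\<integral>\<tau>. F \<tau> \<omega> \<partial>lebesgue) = indicator {0..} \<omega> *\<^sub>R Z \<omega>" for \<omega>
  proof (cases "\<omega> \<ge> 0")
    case True
    have "(\<lambda>\<tau>. exp (- (\<omega> * (t - \<tau>))) * v \<tau>) absolutely_integrable_on S"
    proof (rule absolutely_integrable_bounded_measurable_product_real[OF _ S(1) _ v])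
      show "(\<lambda>\<tau>. exp (- (\<omega> * (t - \<tau>)))) \<in> borel_measurable (lebesgue_on S)"
        by (intro continuous_imp_measurable_on_sets_lebesgue continuous_intros S)
      show "bounded ((\<lambda>\<tau>. exp (- (\<omega> * (t - \<tau>)))) ` S)"
        using True S(2) by (intro boundedI[of _ 1]) (auto intro!: mult_nonneg_nonneg)
    qed
    from set_lebesgue_integral_eq_integral(2)[OF this]
    have "Z \<omega> = (\<integral>\<tau>. \<omega> powr (- \<beta>) * (indicator S \<tau> * (exp (- (\<omega> * (t - \<tau>))) * v \<tau>)) \<partial>lebesgue)"
      unfolding Z_def by (simp add: set_lebesgue_integral_def)
    then show ?thesis
      using True by (simp add: F_def w_def ac_simps)
  qed (simp add: F_def)
  show abs: "Z absolutely_integrable_on {0..}"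
    using integrable_snd[OF F2] unfolding set_integrable_def inner .
  have "integral {0..} Z = (\<integral>\<omega>. \<integral>\<tau>. F \<tau> \<omega> \<partial>lebesgue \<partial>lebesgue)"
    unfolding inner set_lebesgue_integral_eq_integral(2)[OF abs, symmetric]
    by (simp add: set_lebesgue_integral_def)
  also have "\<dots> = (\<integral>\<tau>. \<integral>\<omega>. F \<tau> \<omega> \<partial>lebesgue \<partial>lebesgue)"
    by (rule Fubini_integral[OF F2])
  also have "\<dots> = (\<integral>\<tau>. Gamma (1 - \<beta>) * (w \<tau> * (t - \<tau>) powr (\<beta> - 1)) \<partial>lebesgue)"
  proof (rule integral_cong_AE)
    show "(\<lambda>\<tau>. \<integral>\<omega>. F \<tau> \<omega> \<partial>lebesgue) \<in> borel_measurable lebesgue"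
      using F_meas by measurable
    show "AE \<tau> in lebesgue. (\<integral>\<omega>. F \<tau> \<omega> \<partial>lebesgue) = Gamma (1 - \<beta>) * (w \<tau> * (t - \<tau>) powr (\<beta> - 1))"
      using ae by eventually_elim (use F_int in \<open>auto simp: has_bochner_integral_iff\<close>)
  qed (use k' in auto)
  also have "\<dots> = Gamma (1 - \<beta>) * integral S (\<lambda>\<tau>. (t - \<tau>) powr (\<beta> - 1) * v \<tau>)"
    unfolding set_lebesgue_integral_eq_integral(2)[OF k, symmetric]
    by (subst integral_mult_right_zero) (simp add: set_lebesgue_integral_def w_def ac_simps)
  finally show "integral {0..} Z = \<dots>" .
qed

section \<open>Integrability against the fractional kernel\<close>

text \<open>
  The kernel is singular at \<open>t\<close>, while \<open>f\<close> may be unbounded at \<open>0\<close>.  On each half of the interval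
  one of the two factors is bounded and the other one is integrable.
\<close>
lemma weakly_singular_kernel_integrable:
  fixes f :: "real \<Rightarrow> real"
  assumes "\<beta> > 0" "t > 0"
    and f: "f absolutely_integrable_on {0..t}" and c: "continuous_on {0<..} f"
  shows "(\<lambda>\<tau>. (t - \<tau>) powr (\<beta> - 1) * f \<tau>) absolutely_integrable_on {0..t}"
proof -
  have 1: "(\<lambda>\<tau>. (t - \<tau>) powr (\<beta> - 1) * f \<tau>) absolutely_integrable_on {0..t/2}"
  proof (rule absolutely_integrable_bounded_measurable_product_real)
    have cont: "continuous_on {0..t/2} (\<lambda>\<tau>. (t - \<tau>) powr (\<beta> - 1))"
      using assms by (intro continuous_intros) auto
    then show "(\<lambda>\<tau>. (t - \<tau>) powr (\<beta> - 1)) \<in> borel_measurable (lebesgue_on {0..t/2})"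
      by (intro continuous_imp_measurable_on_sets_lebesgue) auto
    show "bounded ((\<lambda>\<tau>. (t - \<tau>) powr (\<beta> - 1)) ` {0..t/2})"
      by (intro compact_imp_bounded compact_continuous_image cont) auto
    show "f absolutely_integrable_on {0..t/2}"
      using assms by (intro absolutely_integrable_on_subinterval[OF f]) auto
  qed auto
  have "(\<lambda>x. x powr (\<beta> - 1)) integrable_on {0..t/2}"
    using assms by (intro integrable_on_powr_from_0) auto
  then obtain I where "((\<lambda>x. x powr (\<beta> - 1)) has_integral I) (cbox 0 (t/2))" by auto
  from has_integral_affinity[OF this, of "-1" t] 
  have "(\<lambda>\<tau>. (t - \<tau>) powr (\<beta> - 1)) integrable_on ((\<lambda>x. t - x) ` {0..t/2})"
    by (auto simp: integrable_on_def algebra_simps)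
  moreover have "(\<lambda>x. t - x) ` {0..t/2} = {t/2..t}"
    using assms by simp
  ultimately have "(\<lambda>\<tau>. (t - \<tau>) powr (\<beta> - 1)) integrable_on {t/2..t}" by simp
  then have ker: "(\<lambda>\<tau>. (t - \<tau>) powr (\<beta> - 1)) absolutely_integrable_on {t/2..t}"
    by (rule nonnegative_absolutely_integrable_1) auto
  have "(\<lambda>\<tau>. f \<tau> * (t - \<tau>) powr (\<beta> - 1)) absolutely_integrable_on {t/2..t}"
  proof (rule absolutely_integrable_bounded_measurable_product_real[OF _ _ _ ker])
    have cont: "continuous_on {t/2..t} f"
      using assms by (intro continuous_on_subset[OF c]) auto
    then show "f \<in> borel_measurable (lebesgue_on {t/2..t})"
      by (intro continuous_imp_measurable_on_sets_lebesgue) auto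
    show "bounded (f ` {t/2..t})"
      by (intro compact_imp_bounded compact_continuous_image cont) auto
  qed auto
  then have "(\<lambda>\<tau>. (t - \<tau>) powr (\<beta> - 1) * f \<tau>) absolutely_integrable_on {t/2..t}"
    by (simp add: mult.commute)
  from absolutely_integrable_Un[OF 1 this] show ?thesis
    using assms by (simp add: ivl_disj_un_two_touch)
qed

lemma history_kernel_integrable:
  fixes v :: "real \<Rightarrow> real"
  assumes "t > 0" and v: "v absolutely_integrable_on {-a..0}"
  shows "(\<lambda>\<tau>. (t - \<tau>) powr (\<beta> - 1) * v \<tau>) absolutely_integrable_on {-a..0}"
proof (rule absolutely_integrable_bounded_measurable_product_real[OF _ _ _ v])
  have cont: "continuous_on {-a..0} (\<lambda>\<tau>. (t - \<tau>) powr (\<beta> - 1))"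
    using assms by (intro continuous_intros) auto
  then show "(\<lambda>\<tau>. (t - \<tau>) powr (\<beta> - 1)) \<in> borel_measurable (lebesgue_on {-a..0})"
    by (intro continuous_imp_measurable_on_sets_lebesgue) auto
  show "bounded ((\<lambda>\<tau>. (t - \<tau>) powr (\<beta> - 1)) ` {-a..0})"
    by (intro compact_imp_bounded compact_continuous_image cont) auto
qed auto

section \<open>The reflection formula on the real line\<close>

lemma Gamma_reflection_real:
  fixes x :: real
  shows "Gamma x * Gamma (1 - x) = pi / sin (pi * x)"
proof -
  have "Gamma (1 - complex_of_real x) = of_real (Gamma (1 - x))"
    using Gamma_complex_of_real[of "1 - x"] by simp
  moreover have "sin (of_real pi * complex_of_real x) = of_real (sin (pi * x))"
    using sin_of_real[of "pi * x", where 'a = complex] by simp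
  ultimately have "complex_of_real (Gamma x * Gamma (1 - x)) = of_real (pi / sin (pi * x))"
    using Gamma_reflection_complex[of "of_real x"]
    by (simp only: Gamma_complex_of_real of_real_mult of_real_divide)
  then show ?thesis by (simp only: of_real_eq_iff)
qed

section \<open>The state equation\<close>

text \<open>
  The integrand need not be continuous, or even bounded, at the lower end \<open>0\<close>; splitting the
  integral at \<open>t / 2\<close> reduces the claim to the fundamental theorem for continuous functions.
\<close>
lemma integral_has_real_derivative_at:
  fixes g :: "real \<Rightarrow> real"
  assumes g: "g integrable_on {0..2*t}" and c: "continuous_on {0<..} g" and t: "t > 0"
  shows "((\<lambda>x. integral {0..x} g) has_real_derivative g t) (at t)"
proof -
  have "((\<lambda>x. integral {t/2..x} g) has_real_derivative g t) (at t within {t/2..2*t})"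
    using t by (intro integral_has_real_derivative continuous_on_subset[OF c]) auto
  then have "((\<lambda>x. integral {0..t/2} g + integral {t/2..x} g) has_real_derivative g t) (at t)"
    using t by (auto simp: at_within_Icc_at intro!: derivative_eq_intros)
  then show ?thesis
  proof (rule has_field_derivative_transform_within_open[where S="{t/2<..<2*t}"])
    fix x assume "x \<in> {t/2<..<2*t}"
    then show "integral {0..t/2} g + integral {t/2..x} g = integral {0..x} g"
      using t by (intro Henstock_Kurzweil_Integration.integral_combine
            integrable_subinterval_real[OF g]) auto
  qed (use t in auto)
qed


text \<open>The variation of constants formula for the state equation.\<close>
definition driven_state ::
    "real \<Rightarrow> (real \<Rightarrow> real) \<Rightarrow> (real \<Rightarrow> real) \<Rightarrow> real \<Rightarrow> real \<Rightarrow> real" where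
  "driven_state a fin f \<omega> t =
     exp (- (\<omega> * t)) * (integral {-a..0} (\<lambda>\<tau>. exp (\<omega> * \<tau>) * fin \<tau>) +
                         integral {0..t} (\<lambda>\<tau>. exp (\<omega> * \<tau>) * f \<tau>))"

text \<open>
  Absorbing the decay factor into the integrals yields the convolution form, to which
  \<open>frequency_superposition\<close> applies.
\<close>
lemma driven_state_convolution:
  "driven_state a fin f \<omega> t =
     integral {-a..0} (\<lambda>\<tau>. exp (- (\<omega> * (t - \<tau>))) * fin \<tau>) +
     integral {0..t} (\<lambda>\<tau>. exp (- (\<omega> * (t - \<tau>))) * f \<tau>)"
proof -
  have *: "exp (- (\<omega> * (t - \<tau>))) * y = exp (- (\<omega> * t)) * (exp (\<omega> * \<tau>) * y)" for \<tau> y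
    by (simp add: algebra_simps flip: exp_add)
  then show ?thesis
    by (simp only: driven_state_def distrib_left * integral_mult_right)
qed

lemma diffusive_state_driven_state:
  assumes "admissible a fin f"
  shows "diffusive_state a fin f (driven_state a fin f)"
proof -
  have f: "f absolutely_integrable_on {0..T}" if "T > 0" for T
    using assms that by (simp add: admissible_def)
  have c: "continuous_on {0<..} f" using assms by (simp add: admissible_def)
  define g where "g \<omega> \<tau> = exp (\<omega> * \<tau>) * f \<tau>" for \<omega> \<tau>
  have g: "g \<omega> integrable_on {0..T}" if "T > 0" for \<omega> T
  proof -
    have cont: "continuous_on {0..T} (\<lambda>\<tau>. exp (\<omega> * \<tau>))"
      by (intro continuous_intros)
    have "(\<lambda>\<tau>. exp (\<omega> * \<tau>) * f \<tau>) absolutely_integrable_on {0..T}"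
      by (intro absolutely_integrable_bounded_measurable_product_real f that compact_imp_bounded
            compact_continuous_image continuous_imp_measurable_on_sets_lebesgue cont) auto
    then show ?thesis
      unfolding g_def by (rule set_lebesgue_integral_eq_integral(1))
  qed
  have g_cont: "continuous_on {0<..} (g \<omega>)" for \<omega>
    unfolding g_def by (intro continuous_intros c)
  have G_cont: "continuous_on {0..} (\<lambda>t. integral {0..t} (g \<omega>))" for \<omega>
    unfolding continuous_on_eq_continuous_within
  proof
    fix t :: real assume t: "t \<in> {0..}"
    have "continuous_on {0..t+1} (\<lambda>t. integral {0..t} (g \<omega>))"
      using t by (intro indefinite_integral_continuous_1 g) auto
    then have "continuous (at t within {0..t+1}) (\<lambda>t. integral {0..t} (g \<omega>))"
      using t by (auto simp: continuous_on_eq_continuous_within)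
    also have "at t within {0..t+1} = at t within {0..}"
      using t by (intro at_within_nhd[of t "{..<t+1}"]) auto
    finally show "continuous (at t within {0..}) (\<lambda>t. integral {0..t} (g \<omega>))" .
  qed
  have G_deriv: "((\<lambda>t. integral {0..t} (g \<omega>)) has_real_derivative g \<omega> t) (at t)" if "t > 0" for \<omega> t
    using that by (intro integral_has_real_derivative_at g g_cont) auto
  have "exp (- (\<omega> * t)) * g \<omega> t = f t" for \<omega> t
    by (simp add: g_def exp_minus)
  then show ?thesis
    unfolding diffusive_state_def driven_state_def g_def[symmetric]
    by (auto intro!: continuous_intros G_cont derivative_eq_intros G_deriv simp: algebra_simps)
qed

text \<open>
  The difference of two solutions solves the homogeneous equation, so after multiplication by the
  integrating factor \<open>exp (\<omega> s)\<close> it is constant for \<open>s > 0\<close>.  Continuity at \<open>0\<close> carries the common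
  initial value over.
\<close>
lemma diffusive_state_unique:
  assumes y: "diffusive_state a fin f y" and z: "diffusive_state a fin f z"
    and "\<omega> \<ge> 0" "t \<ge> 0"
  shows "y \<omega> t = z \<omega> t"
proof (cases "t = 0")
  case False
  define d where "d s = exp (\<omega> * s) * (y \<omega> s - z \<omega> s)" for s
  have "d t = d 0"
  proof (rule DERIV_isconst_end[where f=d])
    show "continuous_on {0..t} d"
      using assms unfolding d_def diffusive_state_def
      by (auto intro!: continuous_intros intro: continuous_on_subset)
    fix s assume "0 < s" "s < t"
    then have "(y \<omega> has_real_derivative (- \<omega> * y \<omega> s + f s)) (at s)"
      "(z \<omega> has_real_derivative (- \<omega> * z \<omega> s + f s)) (at s)"
      using assms unfolding diffusive_state_def by auto
    then show "(d has_real_derivative 0) (at s)"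
      unfolding d_def by (auto intro!: derivative_eq_intros simp: algebra_simps)
  qed (use False assms in auto)
  also have "d 0 = 0"
    using assms by (simp add: d_def diffusive_state_def)
  finally show ?thesis by (simp add: d_def)
qed (use assms in \<open>simp add: diffusive_state_def\<close>)

section \<open>The diffusive representation\<close>

text \<open>
  The core of both representations.  By uniqueness any state may be replaced by the explicit one;
  the factor \<open>sin (\<beta> * pi) / pi\<close> of the weight is what converts the constant \<open>Gamma (1 - \<beta>)\<close> of
  the frequency integral into the normalization \<open>1 / Gamma \<beta>\<close> of the fractional integral.
\<close>
lemma diffusive_output_eq_init_integral:
  assumes "0 < \<beta>" "\<beta> < 1" and adm: "admissible a fin f"
    and z: "diffusive_state a fin f z" and t: "t > 0"
  shows "(\<lambda>\<omega>. diffusive_weight \<beta> \<omega> * z \<omega> t) absolutely_integrable_on {0..}"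
    and "diffusive_output \<beta> z t = init_integral \<beta> a fin f t"
proof -
  have fin: "fin absolutely_integrable_on {-a..0}" and f: "f absolutely_integrable_on {0..t}"
    and c: "continuous_on {0<..} f"
    using adm t by (auto simp: admissible_def)
  let ?H = "\<lambda>\<omega>. \<omega> powr (- \<beta>) * integral {-a..0} (\<lambda>\<tau>. exp (- (\<omega> * (t - \<tau>))) * fin \<tau>)"
  let ?P = "\<lambda>\<omega>. \<omega> powr (- \<beta>) * integral {0..t} (\<lambda>\<tau>. exp (- (\<omega> * (t - \<tau>))) * f \<tau>)"
  have past: "?H absolutely_integrable_on {0..}"
      "integral {0..} ?H = Gamma (1 - \<beta>) * integral {-a..0} (\<lambda>\<tau>. (t - \<tau>) powr (\<beta> - 1) * fin \<tau>)"
    using assms by (intro frequency_superposition history_kernel_integrable fin; force)+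
  have present: "?P absolutely_integrable_on {0..}"
      "integral {0..} ?P = Gamma (1 - \<beta>) * integral {0..t} (\<lambda>\<tau>. (t - \<tau>) powr (\<beta> - 1) * f \<tau>)"
    using assms by (intro frequency_superposition weakly_singular_kernel_integrable f c; force)+
  have eq: "diffusive_weight \<beta> \<omega> * z \<omega> t = sin (\<beta> * pi) / pi * (?H \<omega> + ?P \<omega>)" if "\<omega> \<in> {0..}" for \<omega>
    using diffusive_state_unique[OF z diffusive_state_driven_state[OF adm], of \<omega> t] t that
    by (simp add: diffusive_weight_def driven_state_convolution algebra_simps)
  have "(\<lambda>\<omega>. sin (\<beta> * pi) / pi * (?H \<omega> + ?P \<omega>)) absolutely_integrable_on {0..}"
    by (intro set_integrable_mult_right set_integral_add past present)
  then show "(\<lambda>\<omega>. diffusive_weight \<beta> \<omega> * z \<omega> t) absolutely_integrable_on {0..}"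
    by (subst set_integrable_cong[OF refl refl eq]) auto
  have "sin (\<beta> * pi) > 0"
    using assms by (intro sin_gt_zero) auto
  moreover have "Gamma \<beta> > 0"
    using assms by (intro Gamma_real_pos)
  ultimately have Gamma: "sin (\<beta> * pi) / pi * Gamma (1 - \<beta>) = 1 / Gamma \<beta>"
    using Gamma_reflection_real[of \<beta>]
    by (simp add: field_simps)
  have "diffusive_output \<beta> z t = integral {0..} (\<lambda>\<omega>. sin (\<beta> * pi) / pi * (?H \<omega> + ?P \<omega>))"
    unfolding diffusive_output_def by (intro Henstock_Kurzweil_Integration.integral_cong eq)
  also have "\<dots> = sin (\<beta> * pi) / pi * (integral {0..} ?H + integral {0..} ?P)"
    using past(1) present(1)
    by (subst integral_mult_right, subst Henstock_Kurzweil_Integration.integral_add)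
       (auto intro: set_lebesgue_integral_eq_integral(1))
  also have "\<dots> = (sin (\<beta> * pi) / pi * Gamma (1 - \<beta>)) *
      (integral {-a..0} (\<lambda>\<tau>. (t - \<tau>) powr (\<beta> - 1) * fin \<tau>) +
       integral {0..t} (\<lambda>\<tau>. (t - \<tau>) powr (\<beta> - 1) * f \<tau>))"
    unfolding past(2) present(2) by (simp only: distrib_left mult.assoc)
  also have "\<dots> = init_integral \<beta> a fin f t"
    unfolding Gamma init_integral_def init_function_def by (simp add: distrib_left)
  finally show "diffusive_output \<beta> z t = init_integral \<beta> a fin f t" .
qed

lemma
  fixes g h :: "real \<Rightarrow> real"
  assumes S: "open S" and eq: "\<And>x. x \<in> S \<Longrightarrow> g x = h x"
  shows higher_deriv_cong_open: "x \<in> S \<Longrightarrow> (deriv ^^ n) g x = (deriv ^^ n) h x"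
    and n_times_differentiable_on_cong:
      "n_times_differentiable_on n g S \<longleftrightarrow> n_times_differentiable_on n h S"
proof -
  have *: "(deriv ^^ k) g x = (deriv ^^ k) h x" if "x \<in> S" for k x
    using eventually_nhds_in_open[OF S that]
    by (intro higher_deriv_cong_ev) (auto elim: eventually_mono simp: eq)
  then show "x \<in> S \<Longrightarrow> (deriv ^^ n) g x = (deriv ^^ n) h x" .
  have "(deriv ^^ k) g differentiable at x \<longleftrightarrow> (deriv ^^ k) h differentiable at x" if "x \<in> S" for k x
  proof -
    have "eventually (\<lambda>y. (deriv ^^ k) g y = (deriv ^^ k) h y) (nhds x)"
      using eventually_nhds_in_open[OF S that] by eventually_elim (rule *)
    then show ?thesis
      by (simp add: real_differentiable_def DERIV_cong_ev[OF refl _ refl])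
  qed
  then show "n_times_differentiable_on n g S \<longleftrightarrow> n_times_differentiable_on n h S"
    unfolding n_times_differentiable_on_def by blast
qed

theorem mainTheorem2:
  fixes n :: nat and \<alpha> a :: real and f fin :: "real \<Rightarrow> real"
  assumes "n \<ge> 1" and "real n - 1 < \<alpha>" and "\<alpha> < real n" and "a \<ge> 0"
  shows
    "(admissible a fin f \<longrightarrow>
        (\<exists>z. diffusive_state a fin f z) \<and>
        (\<forall>z. diffusive_state a fin f z \<longrightarrow>
           (\<forall>t>0. (\<lambda>\<omega>. diffusive_weight (real n - \<alpha>) \<omega> * z \<omega> t) absolutely_integrable_on {0..}) \<and>
           (n_times_differentiable_on n (init_integral (real n - \<alpha>) a fin f) {0<..} \<longleftrightarrow>
            n_times_differentiable_on n (diffusive_output (real n - \<alpha>) z) {0<..}) \<and>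
           (\<forall>t>0. init_RL_deriv n \<alpha> a fin f t = (deriv ^^ n) (diffusive_output (real n - \<alpha>) z) t)))
     \<and>
     (n_times_differentiable_on n f {0<..} \<and>
      n_times_differentiable_on n fin {-a<..<0} \<and>
      admissible a ((deriv ^^ n) fin) ((deriv ^^ n) f) \<longrightarrow>
        (\<exists>z. diffusive_state a ((deriv ^^ n) fin) ((deriv ^^ n) f) z) \<and>
        (\<forall>z. diffusive_state a ((deriv ^^ n) fin) ((deriv ^^ n) f) z \<longrightarrow>
           (\<forall>t>0. (\<lambda>\<omega>. diffusive_weight (real n - \<alpha>) \<omega> * z \<omega> t) absolutely_integrable_on {0..}) \<and>
           (\<forall>t>0. init_Caputo_deriv n \<alpha> a fin f t = diffusive_output (real n - \<alpha>) z t)))"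
proof -
  have \<beta>: "0 < real n - \<alpha>" "real n - \<alpha> < 1"
    using assms by auto
  show ?thesis
  proof (intro conjI impI allI)
    fix z assume adm: "admissible a fin f" and z: "diffusive_state a fin f z"
    have eq: "init_integral (real n - \<alpha>) a fin f t = diffusive_output (real n - \<alpha>) z t"
      if "t \<in> {0<..}" for t
      using diffusive_output_eq_init_integral(2)[OF \<beta> adm z] that by simp
    show "n_times_differentiable_on n (init_integral (real n - \<alpha>) a fin f) {0<..} \<longleftrightarrow>
          n_times_differentiable_on n (diffusive_output (real n - \<alpha>) z) {0<..}"
      by (rule n_times_differentiable_on_cong[OF open_greaterThan eq])
    show "init_RL_deriv n \<alpha> a fin f t = (deriv ^^ n) (diffusive_output (real n - \<alpha>) z) t"
      if "t > 0" for t
      unfolding init_RL_deriv_def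
      by (rule higher_deriv_cong_open[OF open_greaterThan eq]) (use that in auto)
  qed (use diffusive_state_driven_state diffusive_output_eq_init_integral[OF \<beta>] in
        \<open>auto simp: init_Caputo_deriv_def\<close>)
qed

end
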